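(* Let $D^2=\{z=(z_1,z_2)\in\mathbf{C}^2:\ \operatorname{Im} z_2>\tfrac12|z_1|^2\}$ and let $\mathcal F$ be the set of all $z\in D^2$ satisfying \begin{align*} & 0\le \operatorname{Re} z_1,\quad 0\le \operatorname{Im} z_1,\quad \operatorname{Re} z_1+\operatorname{Im} z_1\le 1,\quad |\operatorname{Re} z_2|\le \tfrac12,\quad |z_2|^2\ge 1,\\ & |r+i-(1+i)z_1+z_2|^2\ge 1\quad\text{for } r=-1,0,1,\\ & |r+i-2iz_1+2z_2|^2\ge 2\quad\text{for } r=-1,1,\\ & |r+i-2z_1+2z_2|^2\ge 2\quad\text{for } r=-1,1. \end{align*} Then: (i) $\mathcal F$ is invariant under the involutive transformation $S(z_1,z_2)=(i\bar z_1,-\bar z_2)$. (ii) The two-dimensional edge of $\mathcal F$ at $z_1=0$ is identical to the standard fundamental domain of the modular group: $$\mathcal F\cap\{z_1=0\}=\{(0,z_2)\in\mathbf C^2:\ |\operatorname{Re}z_2|\le\tfrac12,\ \operatorname{Im}z_2>0,\ |z_2|\ge1\}.$$ (iii) $\mathcal F$ has a product structure near infinity, that is, for all large enough $a>0$, \begin{align*} \mathcal F\cap\{z\in\mathbf C^2:\operatorname{Im}z_2\ge a\}=\{z\in\mathbf C^2:\ & 0\le\operatorname{Re}z_1,\ 0\le\operatorname{Im}z_1,\ \operatorname{Re}z_1+\operatorname{Im}z_1\le1,\\ & |\operatorname{Re}z_2|\le\tfrac12,\ \operatorname{Im}z_2\ge a\}. \end{align*}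
   Context: $\mathcal F$ is the paper's fundamental domain for the Picard modular group acting on the hyperquadric model $D^2$ of complex hyperbolic space $\mathbf{CH}^2$; only its explicit description given in the claim is needed here. *)

theory Defs
  imports Complex_Main
begin

definition D2 :: "(complex \<times> complex) set" where
  "D2 = {(z1, z2). Im z2 > (1/2) * (cmod z1)\<^sup>2}"

definition picard_domain :: "(complex \<times> complex) set" where
  "picard_domain = {(z1, z2). (z1, z2) \<in> D2 \<and>
     0 \<le> Re z1 \<and> 0 \<le> Im z1 \<and> Re z1 + Im z1 \<le> 1 \<and>
     \<bar>Re z2\<bar> \<le> 1/2 \<and> (cmod z2)\<^sup>2 \<ge> 1 \<and>
     (\<forall>r\<in>{-1, 0, 1}. (cmod (r + \<i> - (1 + \<i>) * z1 + z2))\<^sup>2 \<ge> 1) \<and>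
     (\<forall>r\<in>{-1, 1}. (cmod (r + \<i> - 2 * \<i> * z1 + 2 * z2))\<^sup>2 \<ge> 2) \<and>
     (\<forall>r\<in>{-1, 1}. (cmod (r + \<i> - 2 * z1 + 2 * z2))\<^sup>2 \<ge> 2)}"

definition S :: "complex \<times> complex \<Rightarrow> complex \<times> complex" where
  "S = (\<lambda>(z1, z2). (\<i> * cnj z1, - cnj z2))"

end

theory Submission
  imports Defs
begin

text \<open>Working form of the domain, obtained by expanding each squared modulus into real and
  imaginary parts. The index \<open>r\<close>, complex in the definition, becomes real here.\<close>

lemma picard_domain_iff:
  "(z1, z2) \<in> picard_domain \<longleftrightarrow>
     (Re z1)\<^sup>2 + (Im z1)\<^sup>2 < 2 * Im z2 \<and>
     0 \<le> Re z1 \<and> 0 \<le> Im z1 \<and> Re z1 + Im z1 \<le> 1 \<and>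
     \<bar>Re z2\<bar> \<le> 1/2 \<and> 1 \<le> (Re z2)\<^sup>2 + (Im z2)\<^sup>2 \<and>
     (\<forall>r\<in>{-1, 0, 1::real}. 1 \<le> (r - Re z1 + Im z1 + Re z2)\<^sup>2 + (1 - Re z1 - Im z1 + Im z2)\<^sup>2) \<and>
     (\<forall>r\<in>{-1, 1::real}. 2 \<le> (r + 2 * Im z1 + 2 * Re z2)\<^sup>2 + (1 - 2 * Re z1 + 2 * Im z2)\<^sup>2) \<and>
     (\<forall>r\<in>{-1, 1::real}. 2 \<le> (r - 2 * Re z1 + 2 * Re z2)\<^sup>2 + (1 - 2 * Im z1 + 2 * Im z2)\<^sup>2)"
proof -
  \<comment> \<open>Clears denominators in the inequality of \<open>D2\<close> once its factor 1/2
    is distributed over the two squares.\<close>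
  have "p / 2 + q / 2 < v \<longleftrightarrow> p + q < v * 2" for p q v :: real
    by auto
  then show ?thesis
    unfolding picard_domain_def D2_def by (simp add: cmod_power2 algebra_simps)
qed

lemma S_S: "S (S z) = z"
  by (cases z) (simp add: S_def complex_eq_iff)

text \<open>In coordinates \<open>S\<close> swaps \<open>Re z\<^sub>1\<close> with \<open>Im z\<^sub>1\<close> and negates \<open>Re z\<^sub>2\<close>; it exchanges
  the last two families of inequalities and maps the index \<open>r\<close> to \<open>-r\<close>.\<close>

lemma S_mem_picard_domain:
  assumes "z \<in> picard_domain"
  shows "S z \<in> picard_domain"
proof -
  obtain z1 z2 where z: "z = (z1, z2)" by (cases z)
  show ?thesis
    using assms unfolding z S_def prod.case picard_domain_iff
    by (simp add: power2_eq_square algebra_simps)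
qed

text \<open>At \<open>z1 = 0\<close> the conditions indexed by \<open>r\<close> follow from the
  others, because their imaginary parts alone are large enough; \<open>s\<close> stands for the real
  part, whose value is irrelevant.\<close>

lemma picard_domain_edge:
  "(0, w) \<in> picard_domain \<longleftrightarrow> \<bar>Re w\<bar> \<le> 1/2 \<and> Im w > 0 \<and> cmod w \<ge> 1"
proof -
  have norm: "1 \<le> cmod w \<longleftrightarrow> 1 \<le> (Re w)\<^sup>2 + (Im w)\<^sup>2"
    by (simp add: cmod_def)
  have large: "1 \<le> s\<^sup>2 + (1 + Im w)\<^sup>2" "2 \<le> s\<^sup>2 + (1 + 2 * Im w)\<^sup>2"
    if "\<bar>Re w\<bar> \<le> 1/2" "Im w > 0" "1 \<le> (Re w)\<^sup>2 + (Im w)\<^sup>2" for s :: real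
  proof -
    \<comment> \<open>Hence \<open>(Im w)\<^sup>2\<close> is at least 3/4, which with
      \<open>Im w > 0\<close> bounds both squares below.\<close>
    have "(Re w)\<^sup>2 \<le> 1/4"
      using power_mono[OF that(1), of 2] by (simp add: power_divide)
    then have "(1 + 2 * Im w)\<^sup>2 \<ge> 2" "(1 + Im w)\<^sup>2 \<ge> 1"
      using that by (simp_all add: power2_sum power_mult_distrib)
    then show "1 \<le> s\<^sup>2 + (1 + Im w)\<^sup>2" "2 \<le> s\<^sup>2 + (1 + 2 * Im w)\<^sup>2"
      by (simp_all add: add_increasing)
  qed
  show ?thesis
    unfolding picard_domain_iff norm using large by auto
qed

text \<open>The height 3/2 makes the imaginary parts in the conditions indexed by \<open>r\<close>
  at least 1 in the first family and at least 1 - 2 + 3 = 2 in the other two, so the real parts can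
  be ignored.\<close>

lemma picard_domain_cusp:
  assumes "3/2 \<le> Im z2" "0 \<le> Re z1" "0 \<le> Im z1" "Re z1 + Im z1 \<le> 1" "\<bar>Re z2\<bar> \<le> 1/2"
  shows "(z1, z2) \<in> picard_domain"
proof -
  \<comment> \<open>Both coordinates lie in [0, 1], so the sum of their squares is at most 1, while
    \<open>2 * Im z2\<close> is at least 3.\<close>
  have "(Re z1)\<^sup>2 \<le> Re z1" "(Im z1)\<^sup>2 \<le> Im z1"
    using assms by (simp_all add: power2_eq_square mult_left_le)
  then have cusp: "(Re z1)\<^sup>2 + (Im z1)\<^sup>2 < 2 * Im z2"
    using assms by linarith
  have one: "1 \<le> s\<^sup>2 + t\<^sup>2" if "1 \<le> t" for s t :: real
    using one_le_power[OF that, of 2] by (simp add: add_increasing)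
  have two: "2 \<le> s\<^sup>2 + t\<^sup>2" if "2 \<le> t" for s t :: real
    using power_mono[OF that, of 2] by (simp add: add_increasing)
  show ?thesis
    unfolding picard_domain_iff
    using assms cusp by (intro conjI ballI one two) auto
qed

theorem theorem3:
  shows "((\<forall>z. S (S z) = z) \<and> S ` picard_domain = picard_domain) \<and>
    picard_domain \<inter> {(z1, z2). z1 = 0} =
      {(0, z2) | z2. \<bar>Re z2\<bar> \<le> 1/2 \<and> Im z2 > 0 \<and> cmod z2 \<ge> 1} \<and>
    (\<exists>a0>0. \<forall>a::real. a \<ge> a0 \<longrightarrow>
       picard_domain \<inter> {(z1, z2). Im z2 \<ge> a} =
         {(z1, z2). 0 \<le> Re z1 \<and> 0 \<le> Im z1 \<and> Re z1 + Im z1 \<le> 1 \<and>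
                    \<bar>Re z2\<bar> \<le> 1/2 \<and> Im z2 \<ge> a})"
proof (intro conjI)
  show "\<forall>z. S (S z) = z"
    by (simp add: S_S)
  show "S ` picard_domain = picard_domain"
    \<comment> \<open>Surjectivity: each \<open>z\<close> in the domain is the image of
      \<open>S z\<close>, which is again in the domain.\<close>
    using S_mem_picard_domain S_S by (metis image_subsetI image_eqI subsetI subset_antisym)
  show "picard_domain \<inter> {(z1, z2). z1 = 0} =
      {(0, z2) | z2. \<bar>Re z2\<bar> \<le> 1/2 \<and> Im z2 > 0 \<and> cmod z2 \<ge> 1}"
    using picard_domain_edge by auto
  have "picard_domain \<inter> {(z1, z2). Im z2 \<ge> a} =
         {(z1, z2). 0 \<le> Re z1 \<and> 0 \<le> Im z1 \<and> Re z1 + Im z1 \<le> 1 \<and>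
                    \<bar>Re z2\<bar> \<le> 1/2 \<and> Im z2 \<ge> a}" if "3/2 \<le> a" for a
  proof (intro set_eqI)
    fix z :: "complex \<times> complex"
    show "z \<in> picard_domain \<inter> {(z1, z2). Im z2 \<ge> a} \<longleftrightarrow>
      z \<in> {(z1, z2). 0 \<le> Re z1 \<and> 0 \<le> Im z1 \<and> Re z1 + Im z1 \<le> 1 \<and>
                    \<bar>Re z2\<bar> \<le> 1/2 \<and> Im z2 \<ge> a}"
      \<comment> \<open>The components are swapped for \<open>picard_domain_cusp\<close> because
        \<open>z2\<close> occurs first in its statement.\<close>
      using that picard_domain_cusp[of "snd z" "fst z"] picard_domain_iff[of "fst z" "snd z"]
      by (cases z) force
  qed
  then show "\<exists>a0>0. \<forall>a::real. a \<ge> a0 \<longrightarrow>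
       picard_domain \<inter> {(z1, z2). Im z2 \<ge> a} =
         {(z1, z2). 0 \<le> Re z1 \<and> 0 \<le> Im z1 \<and> Re z1 + Im z1 \<le> 1 \<and>
                    \<bar>Re z2\<bar> \<le> 1/2 \<and> Im z2 \<ge> a}"
    by (intro exI[of _ "3/2"]) simp
qed

end
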